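(* There exists an absolute constant $C$ such that, for all $\delta,\varepsilon\in(0,1)$ and all nonnegative integers $d,m,n,r$ satisfying $r\ge 2$ and $1\le m\le(1-\delta)\binom{n}{2}$, \[ \mathbb{P}\big(G(n,m)\text{ is not }(d,r,\varepsilon)\text{-rigid}\big)\le\frac{Cr}{\varepsilon}\cdot\left(\left(\frac{d+1}{\delta}+r\right)\cdot\sqrt{\frac{n}{m}}+\sqrt[4]{\frac{n}{m}}\right). \]
   Context: An $r$-cut in a graph $G$ is a partition of its vertex set into $r$ subsets (parts may be empty); its size is the number of edges of $G$ with endpoints in different parts. Let $b_r(G)$ be the maximum size of an $r$-cut of $G$. The deficit of an $r$-cut in $G$ is $b_r(G)$ minus its size. For integers $r\ge 2$ and $d\ge 0$, two vertices are $(d,r)$-equivalent in $G$ if they are in the same part of every $r$-cut in $G$ with deficit at most $d$. An $n$-vertex graph $G$ is $(d,r,\varepsilon)$-rigid, for $\varepsilon>0$, if there are at least $\frac{1-\varepsilon}{r}\binom{n}{2}$ (unordered) pairs of distinct $(d,r)$-equivalent vertices. $G(n,m)$ is the uniformly random graph with vertex set $\{1,\dotsc,n\}$ and exactly $m$ edges. *)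

theory Defs
  imports "HOL-Probability.Probability" "HOL-Library.Ramsey"
begin

text \<open>A simple graph is a pair \<open>(V, E)\<close> of a finite vertex set \<open>V\<close> and an edge set
  \<open>E \<subseteq> nsets V 2\<close>, an edge being a two-element set of vertices.\<close>

type_synonym 'a graph = "'a set \<times> 'a set set"

text \<open>The parts are labelled by \<open>{..<r}\<close> and may be empty; the values \<open>P i\<close> with \<open>i \<ge> r\<close> are
  irrelevant. Neither the size of a cut nor the relation of lying in the same part depends on
  the labelling.\<close>

definition is_rcut :: "nat \<Rightarrow> 'a graph \<Rightarrow> (nat \<Rightarrow> 'a set) \<Rightarrow> bool" where
  "is_rcut r G P \<longleftrightarrow> disjoint_family_on P {..<r} \<and> (\<Union>i<r. P i) = fst G"

definition same_part :: "nat \<Rightarrow> (nat \<Rightarrow> 'a set) \<Rightarrow> 'a \<Rightarrow> 'a \<Rightarrow> bool" where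
  "same_part r P u v \<longleftrightarrow> (\<exists>i<r. u \<in> P i \<and> v \<in> P i)"

definition cut_size :: "nat \<Rightarrow> 'a graph \<Rightarrow> (nat \<Rightarrow> 'a set) \<Rightarrow> nat" where
  "cut_size r G P = card {e \<in> snd G. \<exists>u v. e = {u, v} \<and> \<not> same_part r P u v}"

definition max_cut :: "nat \<Rightarrow> 'a graph \<Rightarrow> nat" where
  "max_cut r G = Max {cut_size r G P | P. is_rcut r G P}"

definition deficit :: "nat \<Rightarrow> 'a graph \<Rightarrow> (nat \<Rightarrow> 'a set) \<Rightarrow> int" where
  "deficit r G P = int (max_cut r G) - int (cut_size r G P)"

definition cut_equivalent :: "nat \<Rightarrow> nat \<Rightarrow> 'a graph \<Rightarrow> 'a \<Rightarrow> 'a \<Rightarrow> bool" where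
  "cut_equivalent d r G u v \<longleftrightarrow>
     (\<forall>P. is_rcut r G P \<and> deficit r G P \<le> int d \<longrightarrow> same_part r P u v)"

definition rigid :: "nat \<Rightarrow> nat \<Rightarrow> real \<Rightarrow> 'a graph \<Rightarrow> bool" where
  "rigid d r \<epsilon> G \<longleftrightarrow>
     (1 - \<epsilon>) / real r * real (card (fst G) choose 2)
       \<le> real (card {e \<in> nsets (fst G) 2. \<exists>u v. e = {u, v} \<and> cut_equivalent d r G u v})"

text \<open>The uniform distribution on all graphs on \<open>{1..n}\<close> with exactly \<open>m\<close> edges; unspecified
  if \<open>m > n choose 2\<close>, when no such graph exists.\<close>

definition random_graph :: "nat \<Rightarrow> nat \<Rightarrow> nat graph pmf" where
  "random_graph n m = pmf_of_set {({1..n}, E) | E. E \<subseteq> nsets {1..n} 2 \<and> card E = m}"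

end

theory Submission
  imports Defs
begin

text \<open>
  Write \<open>N\<close> for the number of pairs of vertices, and let \<open>x\<^sub>j(m)\<close>, \<open>a\<^sub>j(m)\<close>, \<open>z\<^sub>j(m)\<close> be the expected
  proportion of \<open>(j,r)\<close>-equivalent pairs among all pairs, among the edges and among the non-edges of
  \<open>G(n,m)\<close>.

  Let \<open>e\<close> be an edge of \<open>H\<close> whose ends are \<open>(j,r)\<close>-equivalent in \<open>H\<close>. Then they are
  \<open>(j+1,r)\<close>-equivalent in \<open>H - e\<close>: removing \<open>e\<close> does not affect the size of the maximum cuts of \<open>H\<close>,
  which do not separate its ends, and it raises the deficit of every cut that does separate them
  by one, from more than \<open>j\<close> to more than \<open>j + 1\<close>. For
  uniform \<open>H\<close> with \<open>m + 1\<close> edges and a uniform edge \<open>e\<close> of \<open>H\<close>, the pair \<open>(H - e, e)\<close> is a uniform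
  graph with \<open>m\<close> edges and a uniform non-edge of it. Hence \<open>z\<^sub>j\<^sub>+\<^sub>1(m) \<ge> a\<^sub>j(m+1)\<close>. Likewise, if some
  maximum cut of \<open>H\<close> does not separate the ends of \<open>e\<close>, then these are \<open>(0,r)\<close>-equivalent in \<open>H - e\<close>,
  so that \<open>z\<^sub>0(m)\<close> is at least the expected proportion of edges of \<open>G(n,m+1)\<close> inside the parts of a
  chosen maximum cut.

  Moreover \<open>a\<^sub>j\<close> is not much smaller than \<open>x\<^sub>j\<close>, and \<open>z\<^sub>j\<close> not much larger, because for \<^emph>\<open>every\<close>
  partition of the vertex set, the one into equivalence classes included, the number of edges
  between different classes exceeds its expectation by little. For partitions into two sets this is a
  Chernoff bound and a union bound over \<open>2\<^sup>n\<close> sets: the expected maximal excess (\<open>discrepancy\<close>) is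
  \<open>O(sqrt(mn))\<close>. An arbitrary partition loses only a factor of two: group its classes at random into
  two sets; each pair crossing the partition then crosses the bipartition with probability \<open>1/2\<close>,
  while no other pair does (\<open>card_crossing_le_discrepancy\<close>). Relative to the number of edges, the
  excess is \<open>O(sqrt(n/m))\<close>, and relative to the number of non-edges, which is at least of order
  \<open>\<delta> N\<close>, it is \<open>O(sqrt(n/m) / \<delta>)\<close>.

  Altogether \<open>x\<^sub>j\<^sub>+\<^sub>1(m) \<ge> x\<^sub>j(m+1) - O(sqrt(n/m) / \<delta>)\<close>, and \<open>x\<^sub>0(m) \<ge> 1/r - O(sqrt(n/m) / \<delta>)\<close> as the
  parts of an \<open>r\<close>-cut always contain about \<open>N/r\<close> pairs or more. So
  \<open>x\<^sub>d(m) \<ge> 1/r - O((d+1) sqrt(n/m) / \<delta>)\<close> (\<open>mean_equiv_pairs_ge\<close>). Conversely, a maximum cut has at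
  most \<open>m/r\<close> edges inside its parts, so by the same discrepancy bound not many more than \<open>N/r\<close> pairs,
  and these include all equivalent pairs (\<open>card_equiv_pairs_le\<close>). Markov's inequality for the
  non-negative difference of this upper bound and the proportion of equivalent pairs completes the
  proof.
\<close>

text \<open>The number of pairs is treated as a quantity of its own, not as a binomial coefficient.\<close>

declare card_nsets [simp del]

section \<open>Uniformly random subsets of fixed size\<close>

text \<open>The edge sets of the graphs with \<open>m\<close> edges are the \<open>m\<close>-subsets of the set \<open>A\<close> of all pairs.\<close>

abbreviation msubsets :: "'a set \<Rightarrow> nat \<Rightarrow> 'a set set" where
  "msubsets A m \<equiv> {E. E \<subseteq> A \<and> card E = m}"

lemma finite_msubsets: "finite A \<Longrightarrow> finite (msubsets A m)"
  by simp

text \<open>Choosing an \<open>m\<close>-subset and then an element outside it amounts to choosing an \<open>(m+1)\<close>-subset and then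
  an element of it.\<close>

lemma sum_msubsets_insert_remove:
  fixes F :: "'a set \<Rightarrow> 'a \<Rightarrow> real"
  assumes "finite A"
  shows "(\<Sum>E\<in>msubsets A m. \<Sum>e\<in>A - E. F E e)
       = (\<Sum>H\<in>msubsets A (Suc m). \<Sum>e\<in>H. F (H - {e}) e)"
proof -
  have "(\<Sum>E\<in>msubsets A m. \<Sum>e\<in>A - E. F E e)
      = (\<Sum>(E,e)\<in>Sigma (msubsets A m) (\<lambda>E. A - E). F E e)"
    using assms by (intro sum.Sigma) auto
  also have "\<dots> = (\<Sum>(H,e)\<in>Sigma (msubsets A (Suc m)) (\<lambda>H. H). F (H - {e}) e)"
    by (rule sum.reindex_bij_witness[of _ "\<lambda>(H,e). (H - {e}, e)" "\<lambda>(E,e). (insert e E, e)"])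
      (use assms in \<open>auto simp: insert_absorb card_insert_if dest: finite_subset\<close>)
  also have "\<dots> = (\<Sum>H\<in>msubsets A (Suc m). \<Sum>e\<in>H. F (H - {e}) e)"
    using assms by (intro sum.Sigma[symmetric]) (auto dest: finite_subset)
  finally show ?thesis .
qed

lemma Chebyshev_sum_opposite:
  fixes f g :: "'a \<Rightarrow> real"
  assumes "finite A" and opp: "\<And>x y. x \<in> A \<Longrightarrow> y \<in> A \<Longrightarrow> (f x - f y) * (g x - g y) \<le> 0"
  shows "real (card A) * (\<Sum>x\<in>A. f x * g x) \<le> (\<Sum>x\<in>A. f x) * (\<Sum>x\<in>A. g x)"
proof -
  have "(\<Sum>x\<in>A. \<Sum>y\<in>A. (f x - f y) * (g x - g y)) \<le> 0"
    by (intro sum_nonpos opp)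
  moreover have "(\<Sum>x\<in>A. \<Sum>y\<in>A. (f x - f y) * (g x - g y))
      = (\<Sum>x\<in>A. \<Sum>y\<in>A. f x * g x) + (\<Sum>x\<in>A. \<Sum>y\<in>A. f y * g y)
        - (\<Sum>x\<in>A. \<Sum>y\<in>A. f x * g y) - (\<Sum>x\<in>A. \<Sum>y\<in>A. f y * g x)"
    by (simp only: sum.distrib[symmetric] sum_subtractf[symmetric])
       (simp add: algebra_simps)
  moreover have "(\<Sum>x\<in>A. \<Sum>y\<in>A. f x * g y) = (\<Sum>x\<in>A. f x) * (\<Sum>x\<in>A. g x)"
    by (simp add: sum_product)
  moreover have "(\<Sum>x\<in>A. \<Sum>y\<in>A. f y * g x) = (\<Sum>x\<in>A. f x) * (\<Sum>x\<in>A. g x)"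
    by (subst sum.swap) (simp add: sum_product)
  moreover have "(\<Sum>x\<in>A. \<Sum>y\<in>A. f x * g x) = real (card A) * (\<Sum>x\<in>A. f x * g x)"
    by (simp add: sum_distrib_left mult_ac)
  moreover have "(\<Sum>x\<in>A. \<Sum>y\<in>A. f y * g y) = real (card A) * (\<Sum>x\<in>A. f x * g x)"
    by simp
  ultimately show ?thesis
    by linarith
qed

lemma sum_card_diff_msubsets:
  assumes "finite A" "K \<subseteq> A" "m \<le> card A"
  shows "real (card A) * (\<Sum>E\<in>msubsets A m. real (card (K - E)))
       = real (card K) * real (card A - m) * real (card A choose m)"
proof -
  have fK: "finite K" using assms finite_subset by blast
  have "(\<Sum>E\<in>msubsets A m. card (K - E)) = (\<Sum>E\<in>msubsets A m. \<Sum>e\<in>K. if e \<notin> E then 1 else 0)"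
    using fK by (intro sum.cong) (auto simp: sum.If_cases Int_def intro!: arg_cong[of _ _ card])
  also have "\<dots> = (\<Sum>e\<in>K. \<Sum>E\<in>msubsets A m. if e \<notin> E then 1 else 0)"
    by (rule sum.swap)
  also have "\<dots> = (\<Sum>e\<in>K. (card A - 1) choose m)"
  proof (intro sum.cong refl)
    fix e assume "e \<in> K"
    then have "e \<in> A" using assms by auto
    have "(\<Sum>E\<in>msubsets A m. if e \<notin> E then 1 else 0) = card (msubsets A m \<inter> {E. e \<notin> E})"
      using assms by (subst sum.If_cases) auto
    also have "msubsets A m \<inter> {E. e \<notin> E} = msubsets (A - {e}) m" by auto
    also have "card \<dots> = (card A - 1) choose m"
      using assms \<open>e \<in> A\<close> by (simp add: n_subsets)
    finally show "(\<Sum>E\<in>msubsets A m. if e \<notin> E then 1 else 0) = (card A - 1) choose m" .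
  qed
  also have "\<dots> = card K * ((card A - 1) choose m)" by simp
  finally have "card A * (\<Sum>E\<in>msubsets A m. card (K - E))
      = card K * (card A * ((card A - 1) choose m))" by simp
  also have "\<dots> = card K * ((card A - m) * (card A choose m))"
    by (simp add: binomial_absorb_comp)
  finally have "real (card A * (\<Sum>E\<in>msubsets A m. card (K - E)))
      = real (card K * ((card A - m) * (card A choose m)))" by simp
  then show ?thesis by simp
qed

lemma choose_Suc_real:
  assumes "m < N"
  shows "real (Suc m) * real (N choose Suc m) = real (N - m) * real (N choose m)"
proof -
  obtain M where M: "N = Suc M" using assms by (cases N) auto
  have "Suc m * (N choose Suc m) = N * ((N-1) choose m)"
    unfolding M using Suc_times_binomial_eq[of M m] by (simp add: mult.commute)
  also have "\<dots> = (N - m) * (N choose m)" by (simp add: binomial_absorb_comp)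
  finally show ?thesis by (metis of_nat_mult)
qed

text \<open>Sampling without replacement is dominated by sampling with replacement: the generating function
  of the hypergeometric variable \<open>card (E \<inter> K)\<close> is at most that of the binomial variable with the same
  mean. When one more element is drawn, the weight \<open>w ^ card (E \<inter> K)\<close> so far and the number
  \<open>card (K - E)\<close> of remaining elements of \<open>K\<close> are oppositely ordered, so that Chebyshev's sum
  inequality applies.\<close>

lemma hypergeometric_generating_function_le:
  fixes w :: real
  assumes A: "finite A" "A \<noteq> {}" and K: "K \<subseteq> A" and w: "1 \<le> w"
  shows "(\<Sum>E\<in>msubsets A m. w ^ card (E \<inter> K))
    \<le> real (card A choose m) * (1 + real (card K) / real (card A) * (w - 1)) ^ m"
proof (induction m)
  case 0
  have "msubsets A 0 = {{}}" using A by (auto dest: finite_subset)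
  then show ?case by simp
next
  case (Suc m)
  let ?N = "card A" and ?k = "card K"
  define q where "q = 1 + real ?k / real ?N * (w - 1)"
  define s where "s m = (\<Sum>E\<in>msubsets A m. w ^ card (E \<inter> K))" for m
  have N: "?N > 0" using A by (simp add: card_gt_0_iff)
  have fK: "finite K" using A K finite_subset by blast
  have q: "q \<ge> 0" using w by (simp add: q_def)
  show ?case
  proof (cases "m < ?N")
    case False
    then have "card E \<noteq> Suc m" if "E \<subseteq> A" for E
      using card_mono[OF A(1) that] by simp
    then have empty: "msubsets A (Suc m) = {}" by blast
    show ?thesis unfolding empty using False by (simp add: binomial_eq_0)
  next
    case True
    have "real (Suc m) * s (Suc m) = (\<Sum>H\<in>msubsets A (Suc m). \<Sum>e\<in>H. w ^ card (H \<inter> K))"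
      by (simp add: s_def sum_distrib_left)
    also have "\<dots> = (\<Sum>H\<in>msubsets A (Suc m). \<Sum>e\<in>H. w ^ card ((H - {e}) \<inter> K) * (if e \<in> K then w else 1))"
    proof (intro sum.cong refl)
      fix H e assume H: "H \<in> msubsets A (Suc m)" "e \<in> H"
      have fin: "finite (H \<inter> K)" using fK by simp
      have "card (H \<inter> K) = Suc (card ((H - {e}) \<inter> K))" if "e \<in> K"
      proof -
        have "H \<inter> K = insert e ((H - {e}) \<inter> K)" using H that by auto
        then show ?thesis using fin fK by (metis card_insert_disjoint finite_Int DiffE IntE insertI1)
      qed
      moreover have "(H - {e}) \<inter> K = H \<inter> K" if "e \<notin> K" using that by auto
      ultimately show "w ^ card (H \<inter> K) = w ^ card ((H - {e}) \<inter> K) * (if e \<in> K then w else 1)"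
        by auto
    qed
    also have "\<dots> = (\<Sum>E\<in>msubsets A m. \<Sum>e\<in>A - E. w ^ card (E \<inter> K) * (if e \<in> K then w else 1))"
      by (rule sum_msubsets_insert_remove[OF A(1), symmetric])
    also have "\<dots> = (\<Sum>E\<in>msubsets A m. w ^ card (E \<inter> K) * (real (?N - m) + (w - 1) * real (card (K - E))))"
    proof (intro sum.cong refl)
      fix E assume E: "E \<in> msubsets A m"
      have "(\<Sum>e\<in>A - E. (if e \<in> K then w else 1)) = (\<Sum>e\<in>A - E. 1 + (if e \<in> K then w - 1 else 0))"
        by (intro sum.cong) auto
      also have "\<dots> = real (card (A - E)) + (\<Sum>e\<in>A - E. if e \<in> K then w - 1 else 0)"
        by (simp add: sum.distrib)
      also have "(\<Sum>e\<in>A - E. if e \<in> K then w - 1 else 0) = (\<Sum>e\<in>(A - E) \<inter> K. w - 1)"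
        using A by (intro sum.inter_restrict[symmetric]) auto
      also have "(A - E) \<inter> K = K - E" using K by auto
      also have "card (A - E) = ?N - m"
        using E A by (auto simp: card_Diff_subset finite_subset)
      finally show "(\<Sum>e\<in>A - E. w ^ card (E \<inter> K) * (if e \<in> K then w else 1))
        = w ^ card (E \<inter> K) * (real (?N - m) + (w - 1) * real (card (K - E)))"
        by (simp only: sum_distrib_left[symmetric]) (simp add: mult.commute)
    qed
    also have "\<dots> = real (?N - m) * s m
        + (w - 1) * (\<Sum>E\<in>msubsets A m. w ^ card (E \<inter> K) * real (card (K - E)))"
      unfolding s_def sum_distrib_left sum.distrib[symmetric]
      by (intro sum.cong refl) (simp add: algebra_simps)
    finally have rec: "real (Suc m) * s (Suc m) = real (?N - m) * s m
        + (w - 1) * (\<Sum>E\<in>msubsets A m. w ^ card (E \<inter> K) * real (card (K - E)))" .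
    have cm: "real (card (msubsets A m)) = real (?N choose m)" using A by (simp add: n_subsets)
    have cpos: "real (?N choose m) > 0" using True by simp
    have opp: "(w ^ card (E \<inter> K) - w ^ card (F \<inter> K)) * (real (card (K - E)) - real (card (K - F))) \<le> 0"
      for E F
    proof -
      have e: "card (K - E) = ?k - card (E \<inter> K)" "card (E \<inter> K) \<le> ?k"
        "card (K - F) = ?k - card (F \<inter> K)" "card (F \<inter> K) \<le> ?k"
        using fK by (auto simp: card_Diff_subset_Int Int_commute card_mono)
      show ?thesis
      proof (cases "card (E \<inter> K) \<le> card (F \<inter> K)")
        case True
        then have "w ^ card (E \<inter> K) \<le> w ^ card (F \<inter> K)" using w by (rule power_increasing)
        then show ?thesis using True e by (intro mult_nonpos_nonneg) auto
      next
        case False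
        then have "w ^ card (F \<inter> K) \<le> w ^ card (E \<inter> K)" using w by (intro power_increasing) auto
        then show ?thesis using False e by (intro mult_nonneg_nonpos) auto
      qed
    qed
    have "real (?N choose m) * (\<Sum>E\<in>msubsets A m. w ^ card (E \<inter> K) * real (card (K - E)))
        \<le> s m * (\<Sum>E\<in>msubsets A m. real (card (K - E)))"
      using Chebyshev_sum_opposite[OF finite_msubsets[OF A(1), of m] opp] unfolding s_def cm by simp
    also have "(\<Sum>E\<in>msubsets A m. real (card (K - E)))
        = real ?k * real (?N - m) * real (?N choose m) / real ?N"
      using sum_card_diff_msubsets[OF A(1) K, of m] True N by (simp add: field_simps)
    finally have "real (?N choose m) * (\<Sum>E\<in>msubsets A m. w ^ card (E \<inter> K) * real (card (K - E)))
        \<le> real (?N choose m) * (s m * (real ?k / real ?N) * real (?N - m))"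
      by (simp add: field_simps)
    then have "(\<Sum>E\<in>msubsets A m. w ^ card (E \<inter> K) * real (card (K - E)))
        \<le> s m * (real ?k / real ?N) * real (?N - m)"
      using cpos mult_le_cancel_left_pos by blast
    then have "(w - 1) * (\<Sum>E\<in>msubsets A m. w ^ card (E \<inter> K) * real (card (K - E)))
        \<le> (w - 1) * (s m * (real ?k / real ?N) * real (?N - m))"
      using w by (intro mult_left_mono) auto
    with rec have "real (Suc m) * s (Suc m) \<le> real (?N - m) * (s m * q)"
      by (simp add: q_def algebra_simps)
    also have "\<dots> \<le> real (?N - m) * (real (?N choose m) * q ^ m * q)"
      using Suc.IH q by (intro mult_left_mono mult_right_mono) (auto simp: s_def q_def)
    also have "\<dots> = real (Suc m) * (real (?N choose Suc m) * q ^ Suc m)"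
      using choose_Suc_real[OF True] by (simp add: mult_ac)
    finally have "s (Suc m) \<le> real (?N choose Suc m) * q ^ Suc m"
      by (simp only: mult_le_cancel_left_pos of_nat_0_less_iff zero_less_Suc)
    then show ?thesis by (simp add: s_def q_def)
  qed
qed

lemma hypergeometric_exponential_moment:
  fixes l :: real
  assumes A: "finite A" "A \<noteq> {}" and K: "K \<subseteq> A" and l: "0 \<le> l" "l \<le> 1"
  shows "(\<Sum>E\<in>msubsets A m. exp (l * (real (card (E \<inter> K)) - real m / real (card A) * real (card K))))
    \<le> real (card A choose m) * exp (real m * l\<^sup>2)"
proof -
  define q where "q = real (card K) / real (card A)"
  have q: "0 \<le> q" "q \<le> 1"
    using A K by (auto simp: q_def divide_le_eq card_mono card_gt_0_iff)
  have "(\<Sum>E\<in>msubsets A m. exp (l * (real (card (E \<inter> K)) - real m / real (card A) * real (card K))))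
     = exp (- (l * real m * q)) * (\<Sum>E\<in>msubsets A m. exp l ^ card (E \<inter> K))"
    by (simp add: sum_distrib_left exp_of_nat_mult[symmetric] exp_add[symmetric] q_def algebra_simps)
  also have "\<dots> \<le> exp (- (l * real m * q)) * (real (card A choose m) * (1 + q * (exp l - 1)) ^ m)"
    using hypergeometric_generating_function_le[OF A K, of "exp l" m] l
    by (intro mult_left_mono) (auto simp: q_def)
  also have "\<dots> \<le> exp (- (l * real m * q)) * (real (card A choose m) * exp (real m * (q * (l + l\<^sup>2))))"
  proof (intro mult_left_mono)
    have "1 + q * (exp l - 1) \<le> exp (q * (exp l - 1))" by (rule exp_ge_add_one_self)
    also have "\<dots> \<le> exp (q * (l + l\<^sup>2))"
      using exp_bound[OF l] q by (simp add: mult_left_mono)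
    finally have "(1 + q * (exp l - 1)) ^ m \<le> exp (q * (l + l\<^sup>2)) ^ m"
      using q l by (intro power_mono) auto
    then show "(1 + q * (exp l - 1)) ^ m \<le> exp (real m * (q * (l + l\<^sup>2)))"
      by (simp add: exp_of_nat_mult)
  qed auto
  also have "\<dots> = real (card A choose m) * exp (real m * (q * l\<^sup>2))"
    by (simp add: exp_add[symmetric] algebra_simps)
  also have "\<dots> \<le> real (card A choose m) * exp (real m * l\<^sup>2)"
    using q by (intro mult_left_mono) (auto intro!: mult_left_mono mult_left_le_one_le)
  finally show ?thesis .
qed

section \<open>Discrepancy of partitions\<close>

text \<open>The pairs with ends in different classes of the partition of \<open>V\<close> into the fibres of \<open>f\<close>. A
  bipartition \<open>S\<close>, \<open>V - S\<close> is given by the predicate \<open>\<lambda>x. x \<in> S\<close>.\<close>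

definition crossing :: "'a set \<Rightarrow> ('a \<Rightarrow> 'b) \<Rightarrow> 'a set set" where
  "crossing V f = {e \<in> nsets V 2. \<exists>u v. e = {u, v} \<and> f u \<noteq> f v}"

text \<open>The largest excess, over all bipartitions, of the number of crossing edges over its expectation
  for a uniformly random edge set of the same size. It is non-negative because of the trivial
  bipartition.\<close>

definition discrepancy :: "'a set \<Rightarrow> 'a set set \<Rightarrow> real" where
  "discrepancy V E = Max ((\<lambda>S. real (card (E \<inter> crossing V (\<lambda>x. x \<in> S)))
     - real (card E) / real (card (nsets V 2)) * real (card (crossing V (\<lambda>x. x \<in> S)))) ` Pow V)"

lemma crossing_subset: "crossing V f \<subseteq> nsets V 2"
  by (auto simp: crossing_def)

lemma doubleton_in_crossing:
  "{u, v} \<in> crossing V f \<longleftrightarrow> u \<in> V \<and> v \<in> V \<and> f u \<noteq> f v"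
  by (auto simp: crossing_def doubleton_eq_iff)

lemma discrepancy_ge:
  assumes "finite V" "S \<subseteq> V"
  shows "real (card (E \<inter> crossing V (\<lambda>x. x \<in> S)))
    \<le> real (card E) / real (card (nsets V 2)) * real (card (crossing V (\<lambda>x. x \<in> S))) + discrepancy V E"
proof -
  have "real (card (E \<inter> crossing V (\<lambda>x. x \<in> S)))
     - real (card E) / real (card (nsets V 2)) * real (card (crossing V (\<lambda>x. x \<in> S))) \<le> discrepancy V E"
    unfolding discrepancy_def using assms by (intro Max_ge) auto
  then show ?thesis by simp
qed

lemma sum_discrepancy_le:
  assumes V: "finite V" "2 \<le> card V" and m: "card V \<le> m"
  shows "(\<Sum>E\<in>msubsets (nsets V 2) m. discrepancy V E)
    \<le> real (card (nsets V 2) choose m) * (4 * (real m * sqrt (real (card V) / real m)))"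
proof -
  let ?P = "nsets V 2" and ?n = "real (card V)"
  define c where "c = real (card ?P choose m)"
  \<comment> \<open>the value balancing the two terms \<open>n\<close> and \<open>m l\<^sup>2\<close> in the exponents; at most \<open>1\<close> as \<open>n \<le> m\<close>\<close>
  define l where "l = sqrt (?n / real m)"
  define X where "X = (\<lambda>S. crossing V (\<lambda>x. x \<in> S))"
  define Z where "Z = (\<lambda>S E. real (card (E \<inter> X S)) - real m / real (card ?P) * real (card (X S)))"
  have n: "?n \<ge> 2" and m0: "real m > 0" using V m by auto
  have l: "0 < l" "l \<le> 1" "real m * l\<^sup>2 = ?n"
    using n m m0 by (auto simp: l_def divide_le_eq)
  have P: "finite ?P" "?P \<noteq> {}"
  proof -
    have "card ?P \<noteq> 0" using V by (simp add: card_nsets)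
    then show "?P \<noteq> {}" by (metis card.empty)
    show "finite ?P" using V by (simp add: finite_imp_finite_nsets)
  qed
  have "discrepancy V E \<le> (3 * ?n + (\<Sum>S\<in>Pow V. exp (l * Z S E - 3 * ?n))) / l"
    if E: "E \<in> msubsets ?P m" for E
  proof -
    have "discrepancy V E \<in> (\<lambda>S. Z S E) ` Pow V"
      unfolding discrepancy_def Z_def X_def using E V by (auto intro!: Max_in)
    then obtain S where S: "S \<in> Pow V" "discrepancy V E = Z S E" by blast
    \<comment> \<open>a bound on the maximum of the \<open>Z S E\<close> by a sum of exponentials, whose mean is small\<close>
    have "l * Z S E \<le> 3 * ?n + exp (l * Z S E - 3 * ?n)"
      using exp_ge_add_one_self[of "l * Z S E - 3 * ?n"] by linarith
    also have "exp (l * Z S E - 3 * ?n) \<le> (\<Sum>S\<in>Pow V. exp (l * Z S E - 3 * ?n))"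
      using V S by (intro member_le_sum) auto
    finally show ?thesis using l S by (simp add: le_divide_eq mult.commute)
  qed
  then have "(\<Sum>E\<in>msubsets ?P m. discrepancy V E)
      \<le> (\<Sum>E\<in>msubsets ?P m. (3 * ?n + (\<Sum>S\<in>Pow V. exp (l * Z S E - 3 * ?n))) / l)"
    by (intro sum_mono)
  also have "\<dots> = (3 * ?n * c + (\<Sum>S\<in>Pow V. \<Sum>E\<in>msubsets ?P m. exp (l * Z S E - 3 * ?n))) / l"
    unfolding sum_divide_distrib[symmetric] sum.distrib
    using P by (subst sum.swap) (simp add: n_subsets c_def)
  also have "(\<Sum>S\<in>Pow V. \<Sum>E\<in>msubsets ?P m. exp (l * Z S E - 3 * ?n))
      \<le> (\<Sum>S\<in>Pow V. c * exp (- 2 * ?n))"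
  proof (intro sum_mono)
    fix S assume "S \<in> Pow V"
    have "(\<Sum>E\<in>msubsets ?P m. exp (l * Z S E - 3 * ?n))
        = exp (- 3 * ?n) * (\<Sum>E\<in>msubsets ?P m. exp (l * Z S E))"
      by (simp add: sum_distrib_left exp_add[symmetric] algebra_simps)
    also have "\<dots> \<le> exp (- 3 * ?n) * (c * exp (real m * l\<^sup>2))"
      unfolding Z_def c_def X_def
      by (intro mult_left_mono hypergeometric_exponential_moment P crossing_subset) (use l in auto)
    also have "\<dots> = c * exp (- 2 * ?n)"
      by (simp add: l exp_add[symmetric])
    finally show "(\<Sum>E\<in>msubsets ?P m. exp (l * Z S E - 3 * ?n)) \<le> c * exp (- 2 * ?n)" .
  qed
  also have "(\<Sum>S\<in>Pow V. c * exp (- 2 * ?n)) = 2 ^ card V * (c * exp (- 2 * ?n))"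
    using V by (simp add: card_Pow)
  also have "\<dots> \<le> c * ?n"
  proof -
    have "(2::real) ^ card V \<le> exp 1 ^ card V"
      using exp_ge_add_one_self[of 1] by (intro power_mono) auto
    also have "\<dots> = exp ?n" by (simp add: exp_of_nat_mult[symmetric])
    finally have "2 ^ card V * (c * exp (- 2 * ?n)) \<le> exp ?n * (c * exp (- 2 * ?n))"
      by (intro mult_right_mono) (auto simp: c_def)
    also have "\<dots> = c * exp (- ?n)" by (simp add: exp_add[symmetric])
    also have "exp (- ?n) \<le> exp 0" using n by (subst exp_le_cancel_iff) auto
    also have "exp 0 \<le> ?n" using n by simp
    finally show ?thesis by (simp add: c_def mult_left_mono)
  qed
  finally have "(\<Sum>E\<in>msubsets ?P m. discrepancy V E) \<le> c * (4 * (?n / l))"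
    using l by (simp add: divide_right_mono field_simps)
  also have "?n / l = real m * l"
    using l by (simp add: divide_eq_eq power2_eq_square mult.assoc)
  finally show ?thesis by (simp add: c_def l_def)
qed

text \<open>The bound holds for arbitrarily many classes. A uniformly random set \<open>T\<close> of classes defines a
  bipartition, which is crossed with probability \<open>1/2\<close> by the pairs crossing the given partition, and
  never by the others.\<close>

lemma card_crossing_le_discrepancy:
  assumes V: "finite V" and E: "E \<subseteq> nsets V 2"
  shows "real (card (E \<inter> crossing V f))
    \<le> real (card E) / real (card (nsets V 2)) * real (card (crossing V f)) + 2 * discrepancy V E"
proof -
  define K where "K = f ` V"
  define X where "X = (\<lambda>T. crossing V (\<lambda>x. x \<in> {x\<in>V. f x \<in> T}))"
  have K: "finite K" using V by (simp add: K_def)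
  have P: "finite (nsets V 2)" using V by (rule finite_imp_finite_nsets)
  have half: "2 * card {T \<in> Pow K. e \<in> X T} = (if e \<in> crossing V f then 2 ^ card K else 0)"
    if "e \<in> nsets V 2" for e
  proof -
    from that obtain u v where e: "e = {u, v}" "u \<in> V" "v \<in> V" "u \<noteq> v"
      by (rule nsets2_E)
    have iff: "e \<in> X T \<longleftrightarrow> (f u \<in> T) \<noteq> (f v \<in> T)" for T
      using e by (auto simp: X_def doubleton_in_crossing)
    show ?thesis
    proof (cases "f u = f v")
      case True
      then have "{T \<in> Pow K. e \<in> X T} = {}" "e \<notin> crossing V f"
        unfolding iff by (simp_all add: e doubleton_in_crossing)
      then show ?thesis by (simp only:) simp
    next
      case False
      \<comment> \<open>toggling the class of \<open>u\<close> pairs off the sets \<open>T\<close> that are crossed by \<open>e\<close> with the others\<close>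
      have flip: "e \<in> X (sym_diff T {f u}) \<longleftrightarrow> e \<notin> X T" for T
        using False unfolding iff by auto
      have "sym_diff T {f u} \<in> Pow K" if "T \<in> Pow K" for T
        using that e by (auto simp: K_def)
      moreover have "sym_diff (sym_diff T {f u}) {f u} = T" for T
        by blast
      ultimately have "bij_betw (\<lambda>T. sym_diff T {f u}) {T \<in> Pow K. e \<in> X T} {T \<in> Pow K. e \<notin> X T}"
        using flip by (intro bij_betw_byWitness[where f' = "\<lambda>T. sym_diff T {f u}"] ballI)
          (simp_all only: image_subset_iff mem_Collect_eq, blast+)
      then have "card {T \<in> Pow K. e \<in> X T} = card {T \<in> Pow K. e \<notin> X T}"
        by (rule bij_betw_same_card)
      moreover have "card {T \<in> Pow K. e \<in> X T} + card {T \<in> Pow K. e \<notin> X T} = card (Pow K)"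
        using K by (subst card_Un_disjoint[symmetric]) (auto intro!: arg_cong[of _ _ card])
      ultimately show ?thesis using False e K by (simp add: doubleton_in_crossing card_Pow)
    qed
  qed
  have count: "2 * (\<Sum>T\<in>Pow K. card (F \<inter> X T)) = 2 ^ card K * card (F \<inter> crossing V f)"
    if F: "F \<subseteq> nsets V 2" for F
  proof -
    have fF: "finite F" using F P finite_subset by blast
    have "(\<Sum>T\<in>Pow K. card (F \<inter> X T)) = (\<Sum>T\<in>Pow K. \<Sum>e\<in>F. if e \<in> X T then 1 else 0)"
      using fF by (simp add: sum.If_cases Int_def)
    also have "\<dots> = (\<Sum>e\<in>F. \<Sum>T\<in>Pow K. if e \<in> X T then 1 else 0)" by (rule sum.swap)
    also have "\<dots> = (\<Sum>e\<in>F. card {T \<in> Pow K. e \<in> X T})"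
      using K by (simp add: sum.If_cases Int_def)
    finally have "2 * (\<Sum>T\<in>Pow K. card (F \<inter> X T)) = (\<Sum>e\<in>F. 2 * card {T \<in> Pow K. e \<in> X T})"
      by (simp add: sum_distrib_left)
    also have "\<dots> = (\<Sum>e\<in>F. if e \<in> crossing V f then 2 ^ card K else 0)"
      using F by (intro sum.cong refl half) auto
    also have "\<dots> = 2 ^ card K * card (F \<inter> crossing V f)"
      using fF by (simp add: sum.If_cases Int_def)
    finally show ?thesis .
  qed
  define p where "p = real (card E) / real (card (nsets V 2))"
  have XP: "nsets V 2 \<inter> X T = X T" "nsets V 2 \<inter> crossing V f = crossing V f" for T
    using crossing_subset by (auto simp: X_def)
  have "(\<Sum>T\<in>Pow K. real (card (E \<inter> X T))) \<le> (\<Sum>T\<in>Pow K. p * real (card (X T)) + discrepancy V E)"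
    unfolding X_def p_def using V by (intro sum_mono discrepancy_ge) auto
  also have "\<dots> = p * (\<Sum>T\<in>Pow K. real (card (X T))) + 2 ^ card K * discrepancy V E"
    using K by (simp add: sum.distrib sum_distrib_left card_Pow)
  finally have "2 * (\<Sum>T\<in>Pow K. real (card (E \<inter> X T)))
      \<le> p * (2 * (\<Sum>T\<in>Pow K. real (card (X T)))) + 2 ^ card K * (2 * discrepancy V E)" by simp
  moreover have "2 * (\<Sum>T\<in>Pow K. real (card (E \<inter> X T))) = 2 ^ card K * real (card (E \<inter> crossing V f))"
    using arg_cong[OF count[OF E], of real] by simp
  moreover have "2 * (\<Sum>T\<in>Pow K. real (card (X T))) = 2 ^ card K * real (card (crossing V f))"
    using arg_cong[OF count[OF order.refl], of real] by (simp add: XP)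
  ultimately have "2 ^ card K * real (card (E \<inter> crossing V f))
      \<le> 2 ^ card K * (p * real (card (crossing V f)) + 2 * discrepancy V E)"
    by (simp add: algebra_simps)
  then show ?thesis by (simp add: p_def)
qed

lemma real_choose_two: "real (k choose 2) = real k * (real k - 1) / 2"
  by (cases k) (simp_all add: choose_two real_of_nat_div algebra_simps)

text \<open>Convexity: the balanced partition into \<open>r\<close> classes minimises the number of pairs inside them.\<close>

lemma card_not_crossing_ge:
  fixes f :: "'a \<Rightarrow> nat"
  assumes V: "finite V" "2 \<le> card V" and f: "f ` V \<subseteq> {..<r}" and r: "0 < r"
  shows "real (card (nsets V 2 - crossing V f))
    \<ge> (1 / real r - 1 / (real (card V) - 1)) * real (card (nsets V 2))"
proof -
  define A where "A = (\<lambda>i. {x \<in> V. f x = i})"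
  define n where "n = real (card V)"
  have n: "n \<ge> 2" using V by (simp add: n_def)
  have fA: "finite (A i)" for i using V by (simp add: A_def)
  have "nsets V 2 - crossing V f = (\<Union>i<r. nsets (A i) 2)"
    using f by (auto simp: A_def doubleton_in_crossing elim!: nsets2_E)
  then have "card (nsets V 2 - crossing V f) = (\<Sum>i<r. card (nsets (A i) 2))"
    using fA by (simp only:, intro card_UN_disjoint)
      (auto simp: finite_imp_finite_nsets A_def doubleton_eq_iff elim!: nsets2_E)
  then have "real (card (nsets V 2 - crossing V f)) = (\<Sum>i<r. real (card (A i)) * (real (card (A i)) - 1) / 2)"
    by (simp add: card_nsets fA real_choose_two)
  also have "\<dots> = ((\<Sum>i<r. (real (card (A i)))\<^sup>2) - (\<Sum>i<r. real (card (A i)))) / 2"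
    by (simp add: sum_divide_distrib[symmetric] sum_subtractf[symmetric] power2_eq_square algebra_simps)
  also have sumA: "(\<Sum>i<r. real (card (A i))) = n"
  proof -
    have "V = (\<Union>i<r. A i)" using f by (auto simp: A_def)
    then have "card V = card (\<Union>i<r. A i)" by simp
    also have "\<dots> = (\<Sum>i<r. card (A i))"
      using fA by (intro card_UN_disjoint) (auto simp: A_def)
    finally show ?thesis by (simp add: n_def)
  qed
  finally have eq: "real (card (nsets V 2 - crossing V f)) = ((\<Sum>i<r. (real (card (A i)))\<^sup>2) - n) / 2" .
  have "n\<^sup>2 \<le> real r * (\<Sum>i<r. (real (card (A i)))\<^sup>2)"
    using sum_squared_le_sum_of_squares[of "\<lambda>i. real (card (A i))" "{..<r}"]
    by (simp add: sumA mult.commute)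
  then have "n\<^sup>2 / real r \<le> (\<Sum>i<r. (real (card (A i)))\<^sup>2)"
    using r by (simp add: divide_le_eq mult.commute)
  moreover have "(1 / real r - 1 / (n - 1)) * real (card (nsets V 2)) = (n * (n - 1) / real r - n) / 2"
  proof -
    have N: "real (card (nsets V 2)) = n * (n - 1) / 2" using V by (simp add: card_nsets real_choose_two n_def)
    show ?thesis unfolding N using n r by (simp add: divide_simps) (simp add: algebra_simps)
  qed
  moreover have "n * (n - 1) / real r \<le> n\<^sup>2 / real r"
    using n by (intro divide_right_mono) (auto simp: power2_eq_square algebra_simps)
  ultimately show ?thesis unfolding eq n_def[symmetric] by simp
qed

section \<open>Maximum cuts and equivalent pairs\<close>

text \<open>The pairs separated by the cut \<open>P\<close>; the size of the cut in a graph is the number of its edges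
  among them.\<close>

definition cut_pairs :: "'a set \<Rightarrow> nat \<Rightarrow> (nat \<Rightarrow> 'a set) \<Rightarrow> 'a set set" where
  "cut_pairs V r P = {e \<in> nsets V 2. \<exists>u v. e = {u, v} \<and> \<not> same_part r P u v}"

lemma same_part_commute: "same_part r P u v \<longleftrightarrow> same_part r P v u"
  by (auto simp: same_part_def)

lemma doubleton_in_cut_pairs:
  "{u, v} \<in> cut_pairs V r P \<longleftrightarrow> u \<in> V \<and> v \<in> V \<and> u \<noteq> v \<and> \<not> same_part r P u v"
  by (auto simp: cut_pairs_def doubleton_eq_iff same_part_commute)

lemma cut_size_eq:
  "E \<subseteq> nsets V 2 \<Longrightarrow> cut_size r (V, E) P = card (E \<inter> cut_pairs V r P)"
  unfolding cut_size_def cut_pairs_def by (auto intro!: arg_cong[of _ _ card])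

lemma is_rcut_edges: "is_rcut r (V, E) P \<longleftrightarrow> is_rcut r (V, F) P"
  by (simp add: is_rcut_def)

text \<open>Cuts and colourings of the vertices with colours below \<open>r\<close> correspond to each other.\<close>

lemma cut_pairs_eq_crossing:
  assumes "is_rcut r (V, E) P"
  obtains f where "f ` V \<subseteq> {..<r}" "cut_pairs V r P = crossing V f"
proof -
  define f where "f = (\<lambda>u. SOME i. i < r \<and> u \<in> P i)"
  have f: "f u < r \<and> u \<in> P (f u)" if "u \<in> V" for u
    unfolding f_def by (rule someI_ex) (use assms that in \<open>auto simp: is_rcut_def\<close>)
  have uniq: "i = f u" if "i < r" "u \<in> P i" "u \<in> V" for i u
    using assms f[of u] that unfolding is_rcut_def disjoint_family_on_def by fastforce
  have "same_part r P u v \<longleftrightarrow> f u = f v" if "u \<in> V" "v \<in> V" for u v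
    using f uniq that unfolding same_part_def by metis
  then have "cut_pairs V r P = crossing V f"
    by (auto simp: cut_pairs_def crossing_def elim!: nsets2_E) (auto simp: doubleton_eq_iff)
  then show thesis using f by (intro that) auto
qed

lemma cut_of_colouring:
  assumes "f ` V \<subseteq> {..<r}"
  obtains P where "\<And>E. is_rcut r (V, E) P" "cut_pairs V r P = crossing V f"
proof
  let ?P = "\<lambda>i. {x \<in> V. f x = i}"
  show "is_rcut r (V, E) ?P" for E
    using assms by (auto simp: is_rcut_def disjoint_family_on_def)
  have "same_part r ?P u v \<longleftrightarrow> f u = f v" if "u \<in> V" "v \<in> V" for u v
    using assms that by (auto simp: same_part_def)
  then show "cut_pairs V r ?P = crossing V f"
    by (auto simp: cut_pairs_def crossing_def elim!: nsets2_E) (auto simp: doubleton_eq_iff)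
qed

lemma
  assumes V: "finite V" and E: "E \<subseteq> nsets V 2" and r: "0 < r"
  shows cut_size_le_max_cut: "is_rcut r (V, E) P \<Longrightarrow> cut_size r (V, E) P \<le> max_cut r (V, E)"
    and max_cut_attained: "\<exists>P. is_rcut r (V, E) P \<and> cut_size r (V, E) P = max_cut r (V, E)"
proof -
  let ?S = "{cut_size r (V, E) P | P. is_rcut r (V, E) P}"
  have "finite E" using E finite_imp_finite_nsets[OF V] finite_subset by blast
  then have "?S \<subseteq> {..card E}"
    using E by (auto simp: cut_size_eq intro!: card_mono)
  then have fin: "finite ?S" using finite_subset by blast
  show "is_rcut r (V, E) P \<Longrightarrow> cut_size r (V, E) P \<le> max_cut r (V, E)"
    unfolding max_cut_def using fin by (intro Max_ge) auto
  obtain P where "is_rcut r (V, E) P"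
    using r by (rule_tac cut_of_colouring[of "\<lambda>_. 0" V r]) auto
  then have "?S \<noteq> {}" by blast
  from Max_in[OF fin this] show "\<exists>P. is_rcut r (V, E) P \<and> cut_size r (V, E) P = max_cut r (V, E)"
    unfolding max_cut_def by auto
qed

text \<open>A uniformly random \<open>r\<close>-colouring of \<open>V\<close> makes each edge monochromatic with probability \<open>1/r\<close>.\<close>

lemma max_cut_ge:
  assumes V: "finite V" and E: "E \<subseteq> nsets V 2" and r: "0 < r"
  shows "real (max_cut r (V, E)) \<ge> (1 - 1 / real r) * real (card E)"
proof (rule ccontr)
  assume less: "\<not> ?thesis"
  have fE: "finite E" using E finite_imp_finite_nsets[OF V] finite_subset by blast
  define F where "F = V \<rightarrow>\<^sub>E {..<r}"
  have fF: "finite F" and cF: "card F = r ^ card V" "F \<noteq> {}"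
    using V r by (auto simp: F_def card_PiE finite_PiE PiE_eq_empty_iff)
  have mono: "r * card {f \<in> F. e \<notin> crossing V f} = r ^ card V" if e: "e \<in> E" for e
  proof -
    from e E have "e \<in> nsets V 2" by auto
    then obtain u v where uv: "e = {u, v}" "u \<in> V" "v \<in> V" "u \<noteq> v" by (rule nsets2_E)
    \<comment> \<open>recolouring \<open>u\<close> arbitrarily turns the colourings with \<open>f u = f v\<close> into all colourings\<close>
    have "bij_betw (\<lambda>(f, i). f(u := i)) ({f \<in> F. f u = f v} \<times> {..<r}) F"
      by (rule bij_betw_byWitness[where f' = "\<lambda>f. (f(u := f v), f u)"])
        (use uv in \<open>auto simp: F_def PiE_iff extensional_def fun_eq_iff\<close>)
    then have "card ({f \<in> F. f u = f v} \<times> {..<r}) = card F" by (rule bij_betw_same_card)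
    then show ?thesis using uv by (simp add: cF card_cartesian_product doubleton_in_crossing mult.commute)
  qed
  have small: "real r * real (card (E - crossing V f)) > real (card E)" if f: "f \<in> F" for f
  proof -
    have "f ` V \<subseteq> {..<r}" using f by (auto simp: F_def)
    then obtain P where P: "\<And>E. is_rcut r (V, E) P" "cut_pairs V r P = crossing V f"
      by (rule cut_of_colouring) blast
    have "card (E \<inter> crossing V f) \<le> max_cut r (V, E)"
      using cut_size_le_max_cut[OF V E r P(1)] cut_size_eq[OF E] P(2) by metis
    moreover have "card E = card (E \<inter> crossing V f) + card (E - crossing V f)"
      using fE by (subst card_Un_disjoint[symmetric]) (auto intro!: arg_cong[of _ _ card])
    ultimately have "real (card E) - real (card (E - crossing V f)) < (1 - 1 / real r) * real (card E)"
      using less by linarith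
    then show ?thesis using r by (simp add: field_simps)
  qed
  have "real (card F) * real (card E) = (\<Sum>f\<in>F. real (card E))" by simp
  also have "\<dots> < (\<Sum>f\<in>F. real r * real (card (E - crossing V f)))"
    using fF cF small by (intro sum_strict_mono) auto
  also have "\<dots> = real (r * (\<Sum>f\<in>F. card (E - crossing V f)))"
    by (simp add: sum_distrib_left)
  also have "(\<Sum>f\<in>F. card (E - crossing V f)) = (\<Sum>f\<in>F. \<Sum>e\<in>E. if e \<notin> crossing V f then 1 else 0)"
    using fE by (intro sum.cong) (auto simp: sum.If_cases intro!: arg_cong[of _ _ card])
  also have "\<dots> = (\<Sum>e\<in>E. \<Sum>f\<in>F. if e \<notin> crossing V f then 1 else 0)" by (rule sum.swap)
  also have "\<dots> = (\<Sum>e\<in>E. card {f \<in> F. e \<notin> crossing V f})"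
    using fF by (intro sum.cong) (auto simp: sum.If_cases intro!: arg_cong[of _ _ card])
  also have "r * \<dots> = (\<Sum>e\<in>E. r ^ card V)"
    unfolding sum_distrib_left by (intro sum.cong mono refl)
  also have "real \<dots> = real (card F) * real (card E)" by (simp add: cF)
  finally show False by simp
qed

text \<open>The pairs of distinct \<open>(d,r)\<close>-equivalent vertices of the graph \<open>(V, E)\<close>.\<close>

definition equiv_pairs :: "nat \<Rightarrow> nat \<Rightarrow> 'a set \<Rightarrow> 'a set set \<Rightarrow> 'a set set" where
  "equiv_pairs d r V E = {e \<in> nsets V 2. \<exists>u v. e = {u, v} \<and> cut_equivalent d r (V, E) u v}"

lemma cut_equivalent_commute: "cut_equivalent d r G u v \<longleftrightarrow> cut_equivalent d r G v u"
  by (simp add: cut_equivalent_def same_part_commute)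

lemma equiv_pairs_iff:
  "e \<in> equiv_pairs d r V E \<longleftrightarrow> e \<in> nsets V 2 \<and>
    (\<forall>P. is_rcut r (V, E) P \<and> max_cut r (V, E) \<le> cut_size r (V, E) P + d \<longrightarrow> e \<notin> cut_pairs V r P)"
proof (cases "e \<in> nsets V 2")
  case True
  then obtain u v where e: "e = {u, v}" "u \<in> V" "v \<in> V" "u \<noteq> v" by (rule nsets2_E)
  have "e \<in> equiv_pairs d r V E \<longleftrightarrow> cut_equivalent d r (V, E) u v"
    using True e(1) by (auto simp: equiv_pairs_def doubleton_eq_iff cut_equivalent_commute)
  then show ?thesis using e
    by (auto simp: cut_equivalent_def deficit_def doubleton_in_cut_pairs)
qed (simp add: equiv_pairs_def)

lemma equiv_pairs_subset: "equiv_pairs d r V E \<subseteq> nsets V 2"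
  by (auto simp: equiv_pairs_def)

text \<open>Equivalence is transitive, so the inequivalent pairs are those crossing the partition into
  equivalence classes.\<close>

lemma nsets_minus_equiv_pairs:
  obtains f :: "'a \<Rightarrow> 'a set" where "nsets V 2 - equiv_pairs d r V E = crossing V f"
proof
  define f where "f u = {w \<in> V. cut_equivalent d r (V, E) u w}" for u
  have refl: "cut_equivalent d r (V, E) u u" if "u \<in> V" for u
    using that by (auto simp: cut_equivalent_def is_rcut_def same_part_def)
  have "same_part r P u w" if "is_rcut r (V, E) P" "same_part r P u v" "same_part r P v w" for P u v w
  proof -
    from that obtain i j where ij: "i < r" "u \<in> P i" "v \<in> P i" "j < r" "v \<in> P j" "w \<in> P j"
      unfolding same_part_def by blast
    with that(1) have "i = j" unfolding is_rcut_def disjoint_family_on_def by blast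
    with ij show ?thesis unfolding same_part_def by blast
  qed
  then have trans: "cut_equivalent d r (V, E) u w"
    if "cut_equivalent d r (V, E) u v" "cut_equivalent d r (V, E) v w" for u v w
    using that unfolding cut_equivalent_def by blast
  have "f u = f v \<longleftrightarrow> cut_equivalent d r (V, E) u v" if "u \<in> V" "v \<in> V" for u v
  proof
    assume "f u = f v"
    moreover have "v \<in> f v" using refl that by (simp add: f_def)
    ultimately have "v \<in> f u" by simp
    then show "cut_equivalent d r (V, E) u v" by (simp add: f_def)
  next
    assume uv: "cut_equivalent d r (V, E) u v"
    then have vu: "cut_equivalent d r (V, E) v u" by (subst cut_equivalent_commute)
    show "f u = f v" using trans[OF uv] trans[OF vu] by (auto simp: f_def)
  qed
  then show "nsets V 2 - equiv_pairs d r V E = crossing V f"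
    by (auto simp: equiv_pairs_def crossing_def elim!: nsets2_E) (auto simp: doubleton_eq_iff, blast)
qed

lemma cut_size_remove_edge:
  assumes V: "finite V" and H: "H \<subseteq> nsets V 2" "e \<in> H"
  shows "cut_size r (V, H) P = cut_size r (V, H - {e}) P + (if e \<in> cut_pairs V r P then 1 else 0)"
proof -
  have fH: "finite H" using H finite_imp_finite_nsets[OF V] finite_subset by blast
  have H': "H - {e} \<subseteq> nsets V 2" using H by auto
  show ?thesis
  proof (cases "e \<in> cut_pairs V r P")
    case True
    have "H \<inter> cut_pairs V r P = insert e ((H - {e}) \<inter> cut_pairs V r P)" using True H by auto
    then show ?thesis using True fH by (simp add: cut_size_eq[OF H(1)] cut_size_eq[OF H'])
  next
    case False
    then have "H \<inter> cut_pairs V r P = (H - {e}) \<inter> cut_pairs V r P" by auto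
    then show ?thesis using False by (simp add: cut_size_eq[OF H(1)] cut_size_eq[OF H'])
  qed
qed

text \<open>A cut of \<open>H - {e}\<close> that is maximum and separates \<open>e\<close> would gain one edge in \<open>H\<close>, and so be larger
  there than the maximum cut \<open>Q\<close>, which does not separate \<open>e\<close>.\<close>

lemma equiv_pairs_0_remove_edge:
  assumes V: "finite V" and H: "H \<subseteq> nsets V 2" "e \<in> H" and r: "0 < r"
    and Q: "is_rcut r (V, H) Q" "cut_size r (V, H) Q = max_cut r (V, H)" "e \<notin> cut_pairs V r Q"
  shows "e \<in> equiv_pairs 0 r V (H - {e})"
  unfolding equiv_pairs_iff
proof (intro conjI allI impI notI)
  show "e \<in> nsets V 2" using H by auto
  fix P assume P: "is_rcut r (V, H - {e}) P \<and> max_cut r (V, H - {e}) \<le> cut_size r (V, H - {e}) P + 0"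
    and cut: "e \<in> cut_pairs V r P"
  have H': "H - {e} \<subseteq> nsets V 2" using H by auto
  have "cut_size r (V, H - {e}) Q \<le> max_cut r (V, H - {e})"
    using cut_size_le_max_cut[OF V H' r] Q(1) is_rcut_edges by blast
  moreover have "cut_size r (V, H) P \<le> max_cut r (V, H)"
    using cut_size_le_max_cut[OF V H(1) r] P is_rcut_edges by blast
  ultimately show False
    using P Q cut cut_size_remove_edge[OF V H, of r P] cut_size_remove_edge[OF V H, of r Q] by simp
qed

text \<open>The two graphs have maximum cuts of the same size, since those of \<open>H\<close> do not separate \<open>e\<close>. So the
  deficit of a cut separating \<open>e\<close> is smaller by one in \<open>H\<close> than in \<open>H - {e}\<close>.\<close>

lemma equiv_pairs_Suc_remove_edge:
  assumes V: "finite V" and H: "H \<subseteq> nsets V 2" "e \<in> H" and r: "0 < r"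
    and e: "e \<in> equiv_pairs d r V H"
  shows "e \<in> equiv_pairs (Suc d) r V (H - {e})"
  unfolding equiv_pairs_iff
proof (intro conjI allI impI notI)
  show "e \<in> nsets V 2" using H by auto
  fix P assume P: "is_rcut r (V, H - {e}) P \<and> max_cut r (V, H - {e}) \<le> cut_size r (V, H - {e}) P + Suc d"
    and cut: "e \<in> cut_pairs V r P"
  have H': "H - {e} \<subseteq> nsets V 2" using H by auto
  obtain Q where Q: "is_rcut r (V, H) Q" "cut_size r (V, H) Q = max_cut r (V, H)"
    using max_cut_attained[OF V H(1) r] by blast
  have "e \<notin> cut_pairs V r Q" using e Q by (auto simp: equiv_pairs_iff)
  then have "max_cut r (V, H) = cut_size r (V, H - {e}) Q"
    using Q cut_size_remove_edge[OF V H, of r Q] by simp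
  also have "\<dots> \<le> max_cut r (V, H - {e})"
    using cut_size_le_max_cut[OF V H' r] Q(1) is_rcut_edges by blast
  finally have "max_cut r (V, H) \<le> cut_size r (V, H) P + d"
    using P cut cut_size_remove_edge[OF V H, of r P] by simp
  moreover have "is_rcut r (V, H) P" using P is_rcut_edges by blast
  ultimately show False using e cut by (auto simp: equiv_pairs_iff)
qed

section \<open>Expected number of equivalent pairs\<close>

text \<open>The expectation of \<open>F\<close> at a uniformly random \<open>m\<close>-subset of \<open>A\<close>; zero if there is no such subset.\<close>

definition mean :: "'a set \<Rightarrow> nat \<Rightarrow> ('a set \<Rightarrow> real) \<Rightarrow> real" where
  "mean A m F = (\<Sum>E\<in>msubsets A m. F E) / real (card A choose m)"

lemma mean_mono:
  assumes "\<And>E. E \<subseteq> A \<Longrightarrow> card E = m \<Longrightarrow> F E \<le> G E"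
  shows "mean A m F \<le> mean A m G"
  unfolding mean_def using assms by (intro divide_right_mono sum_mono) auto

lemma mean_add: "mean A m (\<lambda>E. F E + G E) = mean A m F + mean A m G"
  by (simp add: mean_def sum.distrib add_divide_distrib)

lemma mean_diff: "mean A m (\<lambda>E. F E - G E) = mean A m F - mean A m G"
  by (simp add: mean_def sum_subtractf diff_divide_distrib)

lemma mean_cmult: "mean A m (\<lambda>E. c * F E) = c * mean A m F"
  by (simp add: mean_def sum_distrib_left)

lemma mean_const: "finite A \<Longrightarrow> m \<le> card A \<Longrightarrow> mean A m (\<lambda>E. c) = c"
  by (simp add: mean_def n_subsets)

lemma mean_insert_remove:
  assumes "finite A" "m < card A"
  shows "mean A m (\<lambda>E. \<Sum>e\<in>A - E. F E e) / real (card A - m)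
       = mean A (Suc m) (\<lambda>H. \<Sum>e\<in>H. F (H - {e}) e) / real (Suc m)"
  unfolding mean_def sum_msubsets_insert_remove[OF assms(1)] divide_divide_eq_left
  using choose_Suc_real[OF assms(2)] by (simp only: mult.commute)

lemma card_noncrossing_ge:
  assumes V: "finite V" and E: "E \<subseteq> nsets V 2" and B: "B \<subseteq> nsets V 2" "nsets V 2 - B = crossing V f"
  shows "real (card (E \<inter> B)) \<ge> real (card E) / real (card (nsets V 2)) * real (card B) - 2 * discrepancy V E"
proof -
  let ?P = "nsets V 2"
  have fin: "finite ?P" "finite E" "finite B"
    using V E B finite_imp_finite_nsets finite_subset by blast+
  have "card (E \<inter> B) + card (E \<inter> crossing V f) = card E"
    using fin E by (subst card_Un_disjoint[symmetric]) (auto simp: B(2)[symmetric] intro!: arg_cong[of _ _ card])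
  moreover have "card B + card (crossing V f) = card ?P"
    using card_Diff_subset[OF fin(3) B(1)] card_mono[OF fin(1) B(1)] by (simp only: B(2)[symmetric])
  ultimately have eq: "real (card (E \<inter> crossing V f)) = real (card E) - real (card (E \<inter> B))"
    "real (card (crossing V f)) = real (card ?P) - real (card B)" by linarith+
  have "real (card E) / real (card ?P) * real (card ?P) = real (card E)"
    using E fin by (cases "card ?P = 0") auto
  then show ?thesis
    using card_crossing_le_discrepancy[OF V E, of f] unfolding eq by (simp add: right_diff_distrib)
qed

text \<open>The step from \<open>m + 1\<close> to \<open>m\<close> edges. The set \<open>B H\<close> consists of the pairs inside the classes of a
  partition, and its members that are edges \<open>e\<close> of \<open>H\<close> become \<open>(d,r)\<close>-equivalent in \<open>H - {e}\<close>. It is used with the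
  partition into \<open>(d-1,r)\<close>-equivalence classes and, for \<open>d = 0\<close>, with a maximum cut. The two error
  terms come from replacing all pairs by edges of \<open>H\<close>, and non-edges of \<open>H - {e}\<close> by all pairs.\<close>

lemma mean_equiv_pairs_step:
  fixes B :: "'a set set \<Rightarrow> 'a set set"
  assumes V: "finite V" and m: "m < card (nsets V 2)"
    and B: "\<And>H. H \<subseteq> nsets V 2 \<Longrightarrow> B H \<subseteq> nsets V 2"
      "\<And>H. H \<subseteq> nsets V 2 \<Longrightarrow> \<exists>f :: 'a \<Rightarrow> 'b. nsets V 2 - B H = crossing V f"
    and remove: "\<And>H e. H \<subseteq> nsets V 2 \<Longrightarrow> e \<in> H \<Longrightarrow> e \<in> B H \<Longrightarrow> e \<in> equiv_pairs d r V (H - {e})"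
  shows "mean (nsets V 2) m (\<lambda>E. card (equiv_pairs d r V E)) / real (card (nsets V 2))
    \<ge> mean (nsets V 2) (Suc m) (\<lambda>H. card (B H)) / real (card (nsets V 2))
      - (2 * mean (nsets V 2) (Suc m) (discrepancy V) / real (Suc m)
        + 2 * mean (nsets V 2) m (discrepancy V) / real (card (nsets V 2) - m))"
proof -
  let ?P = "nsets V 2"
  define N where "N = real (card ?P)"
  define Q where "Q = equiv_pairs d r V"
  have P: "finite ?P" using V by (rule finite_imp_finite_nsets)
  have N: "N > 0" "real (card ?P - m) = N - real m" "N - real m > 0" using m unfolding N_def by linarith+
  have Q: "Q E \<subseteq> ?P" "finite (Q E)" for E
    using equiv_pairs_subset[of d r V E] P finite_subset by (auto simp: Q_def)

  have "mean ?P (Suc m) (\<lambda>H. card (B H)) / N - 2 * mean ?P (Suc m) (discrepancy V) / real (Suc m)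
      = mean ?P (Suc m) (\<lambda>H. real (Suc m) / N * real (card (B H)) - 2 * discrepancy V H) / real (Suc m)"
    unfolding mean_diff mean_cmult by (simp add: diff_divide_distrib del: of_nat_Suc)
  also have "\<dots> \<le> mean ?P (Suc m) (\<lambda>H. \<Sum>e\<in>H. if e \<in> Q (H - {e}) then 1 else 0) / real (Suc m)"
  proof (intro divide_right_mono mean_mono)
    fix H assume H: "H \<subseteq> ?P" "card H = Suc m"
    have fH: "finite H" using H P finite_subset by blast
    obtain f :: "'a \<Rightarrow> 'b" where "?P - B H = crossing V f" using B(2)[OF H(1)] by blast
    from card_noncrossing_ge[OF V H(1) B(1)[OF H(1)] this]
    have "real (Suc m) / N * real (card (B H)) - 2 * discrepancy V H \<le> real (card (H \<inter> B H))"
      by (simp only: H(2) N_def)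
    also have "\<dots> = (\<Sum>e\<in>H. if e \<in> B H then 1 else 0)"
      using fH by (simp add: sum.If_cases)
    also have "\<dots> \<le> (\<Sum>e\<in>H. if e \<in> Q (H - {e}) then 1 else 0)"
      using remove[OF H(1)] by (intro sum_mono) (auto simp: Q_def)
    finally show "real (Suc m) / N * real (card (B H)) - 2 * discrepancy V H
      \<le> (\<Sum>e\<in>H. if e \<in> Q (H - {e}) then 1 else 0)" .
  qed simp
  also have "\<dots> = mean ?P m (\<lambda>E. \<Sum>e\<in>?P - E. if e \<in> Q E then 1 else 0) / real (card ?P - m)"
    by (rule mean_insert_remove[OF P m, symmetric])
  also have "\<dots> \<le> mean ?P m (\<lambda>E. (1 - real m / N) * real (card (Q E)) + 2 * discrepancy V E) / real (card ?P - m)"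
  proof (intro divide_right_mono mean_mono)
    fix E assume E: "E \<subseteq> ?P" "card E = m"
    have "(\<Sum>e\<in>?P - E. if e \<in> Q E then 1 else 0) = real (card ((?P - E) \<inter> Q E))"
      using P by (simp add: sum.If_cases)
    also have "(?P - E) \<inter> Q E = Q E - E" using Q by auto
    also have "real (card (Q E - E)) = real (card (Q E)) - real (card (E \<inter> Q E))"
      using Q by (simp add: card_Diff_subset_Int Int_commute of_nat_diff card_mono)
    also have "\<dots> \<le> (1 - real m / N) * real (card (Q E)) + 2 * discrepancy V E"
    proof -
      obtain f :: "'a \<Rightarrow> 'a set" where "?P - Q E = crossing V f"
        unfolding Q_def by (rule nsets_minus_equiv_pairs)
      from card_noncrossing_ge[OF V E(1) Q(1) this] show ?thesis
        by (simp add: E(2) N_def left_diff_distrib)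
    qed
    finally show "(\<Sum>e\<in>?P - E. if e \<in> Q E then 1 else 0)
      \<le> (1 - real m / N) * real (card (Q E)) + 2 * discrepancy V E" .
  qed simp
  also have "\<dots> = (1 - real m / N) / (N - real m) * mean ?P m (\<lambda>E. card (Q E))
      + 2 * mean ?P m (discrepancy V) / real (card ?P - m)"
    unfolding mean_add mean_cmult by (simp add: add_divide_distrib N)
  also have "(1 - real m / N) / (N - real m) = 1 / N"
    using N by (simp add: field_simps)
  finally show ?thesis by (simp add: N_def Q_def)
qed

lemma mean_discrepancy_le:
  assumes "finite V" "2 \<le> card V" "card V \<le> m" "m \<le> card (nsets V 2)"
  shows "mean (nsets V 2) m (discrepancy V) \<le> 4 * (real m * sqrt (real (card V) / real m))"
proof -
  have "real (card (nsets V 2) choose m) > 0" using assms(4) by (simp)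
  then show ?thesis
    using sum_discrepancy_le[OF assms(1-3)] unfolding mean_def by (simp only: divide_le_eq mult.commute if_True)
qed

text \<open>By induction on \<open>d\<close>, with one step for each value of the deficit. The second assumption on \<open>m\<close>
  ensures that a proportion of at least \<open>\<delta>/2\<close> of the pairs are non-edges in all graphs considered.\<close>

lemma mean_equiv_pairs_ge:
  fixes V :: "'a set" and \<delta> :: real
  assumes V: "finite V" "2 \<le> card V" and r: "0 < r" and \<delta>: "0 < \<delta>" "\<delta> \<le> 1"
    and m: "card V \<le> m" "real (m + d + 1) \<le> (1 - \<delta> / 2) * real (card (nsets V 2))"
  shows "mean (nsets V 2) m (\<lambda>E. card (equiv_pairs d r V E)) / real (card (nsets V 2))
    \<ge> 1 / real r - 25 * (real (d + 1) / \<delta>) * sqrt (real (card V) / real m)"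
proof -
  let ?P = "nsets V 2"
  define N where "N = real (card ?P)"
  define \<eta> where "\<eta> k = sqrt (real (card V) / real k)" for k
  define x where "x d m = mean ?P m (\<lambda>E. card (equiv_pairs d r V E)) / N" for d m
  define loss where "loss m = 2 * mean ?P (Suc m) (discrepancy V) / real (Suc m)
      + 2 * mean ?P m (discrepancy V) / real (card ?P - m)" for m
  have n: "real (card V) \<ge> 2" using V by simp
  have \<eta>_anti: "\<eta> k' \<le> \<eta> k" if "card V \<le> k" "k \<le> k'" for k k'
    using that n by (auto simp: \<eta>_def intro!: divide_left_mono)
  have \<eta>0: "\<eta> k \<ge> 0" for k by (simp add: \<eta>_def)
  have small: "m < card ?P" "real (card ?P - m) \<ge> \<delta> / 2 * N" "real m \<le> N" "N > 0"
    if "real (m + 1) \<le> (1 - \<delta> / 2) * N" for m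
  proof -
    have N0: "0 \<le> \<delta> / 2 * N" using \<delta> by (simp add: N_def)
    then have le: "real m + 1 + \<delta> / 2 * N \<le> N" using that by (simp add: algebra_simps)
    then show lt: "m < card ?P" "real m \<le> N" "N > 0" using N0 unfolding N_def by linarith+
    show "real (card ?P - m) \<ge> \<delta> / 2 * N" using le lt unfolding N_def by linarith
  qed
  \<comment> \<open>an error of \<open>8 \<eta>\<close> for the edges, and one of \<open>16 \<eta> / \<delta>\<close> for the non-edges\<close>
  have loss: "loss m \<le> 24 / \<delta> * \<eta> m" if m: "card V \<le> m" "real (m + 1) \<le> (1 - \<delta> / 2) * N" for m
  proof -
    note s = small[OF m(2)]
    have mpos: "real m > 0" using m n by linarith
    have "2 * mean ?P (Suc m) (discrepancy V) / real (Suc m)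
        \<le> 2 * (4 * (real (Suc m) * \<eta> (Suc m))) / real (Suc m)"
      unfolding \<eta>_def using m s V by (intro divide_right_mono mult_left_mono mean_discrepancy_le) auto
    also have "\<dots> = 8 * \<eta> (Suc m)" by (simp del: of_nat_Suc)
    also have "\<dots> \<le> 8 * \<eta> m" using \<eta>_anti[of m "Suc m"] m by simp
    also have "\<dots> \<le> 8 / \<delta> * \<eta> m"
      using \<delta> \<eta>0[of m] by (intro mult_right_mono) (auto simp: le_divide_eq)
    finally have A: "2 * mean ?P (Suc m) (discrepancy V) / real (Suc m) \<le> 8 / \<delta> * \<eta> m" .
    have "2 * mean ?P m (discrepancy V) / real (card ?P - m)
        \<le> 2 * (4 * (real m * \<eta> m)) / real (card ?P - m)"
      unfolding \<eta>_def using m s V by (intro divide_right_mono mult_left_mono mean_discrepancy_le) auto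
    also have "\<dots> \<le> 2 * (4 * (N * \<eta> m)) / (\<delta> / 2 * N)"
      using s \<eta>0[of m] \<delta> by (intro frac_le mult_left_mono mult_right_mono) auto
    also have "\<dots> = 16 / \<delta> * \<eta> m" using s by simp
    finally have B: "2 * mean ?P m (discrepancy V) / real (card ?P - m) \<le> 16 / \<delta> * \<eta> m" .
    from A B show ?thesis unfolding loss_def by (simp add: add_divide_distrib[symmetric] distrib_right[symmetric])
  qed
  have "x d m \<ge> 1 / real r - 25 * (real (d + 1) / \<delta>) * \<eta> m"
    if "card V \<le> m" "real (m + d + 1) \<le> (1 - \<delta> / 2) * N" for d m
    using that
  proof (induction d arbitrary: m)
    case 0
    then have m: "card V \<le> m" "real (m + 1) \<le> (1 - \<delta> / 2) * N" by simp_all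
    note s = small[OF m(2)]
    define C where "C H = (SOME Q. is_rcut r (V, H) Q \<and> cut_size r (V, H) Q = max_cut r (V, H))" for H
    define B where "B H = ?P - cut_pairs V r (C H)" for H
    have C: "is_rcut r (V, H) (C H)" "cut_size r (V, H) (C H) = max_cut r (V, H)" if "H \<subseteq> ?P" for H
      using someI_ex[OF max_cut_attained[OF V(1) that r]] unfolding C_def by blast+
    have colour: "\<exists>f. f ` V \<subseteq> {..<r} \<and> ?P - B H = crossing V f" if H: "H \<subseteq> ?P" for H
    proof -
      obtain f where f: "f ` V \<subseteq> {..<r}" "cut_pairs V r (C H) = crossing V f"
        by (rule cut_pairs_eq_crossing[OF C(1)[OF H]])
      then have "?P - B H = crossing V f" using crossing_subset[of V f] by (auto simp: B_def)
      with f show ?thesis by blast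
    qed
    have "x 0 m \<ge> mean ?P (Suc m) (\<lambda>H. card (B H)) / N - loss m"
      unfolding x_def N_def loss_def
    proof (rule mean_equiv_pairs_step[OF V(1) s(1)])
      fix H e assume H: "H \<subseteq> ?P"
      show "B H \<subseteq> ?P" by (auto simp: B_def)
      show "\<exists>f :: 'a \<Rightarrow> nat. ?P - B H = crossing V f" using colour[OF H] by blast
      assume "e \<in> H" "e \<in> B H"
      then show "e \<in> equiv_pairs 0 r V (H - {e})"
        by (intro equiv_pairs_0_remove_edge[OF V(1) H _ r C[OF H]]) (auto simp: B_def)
    qed
    moreover have "mean ?P (Suc m) (\<lambda>H. (1 / real r - 1 / (real (card V) - 1)) * N)
        \<le> mean ?P (Suc m) (\<lambda>H. card (B H))"
    proof (rule mean_mono)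
      fix H assume "H \<subseteq> ?P"
      from colour[OF this] obtain f where f: "f ` V \<subseteq> {..<r}" "?P - B H = crossing V f" by blast
      have "B H = ?P - crossing V f" using f(2) by (auto simp: B_def)
      then show "(1 / real r - 1 / (real (card V) - 1)) * N \<le> real (card (B H))"
        using card_not_crossing_ge[OF V f(1) r] by (simp only: N_def)
    qed
    then have "1 / real r - 1 / (real (card V) - 1) \<le> mean ?P (Suc m) (\<lambda>H. card (B H)) / N"
      using s mean_const[OF finite_imp_finite_nsets[OF V(1)], of "Suc m"] by (simp add: le_divide_eq Suc_le_eq)
    \<comment> \<open>this raises the constant from \<open>24\<close> to \<open>25\<close>\<close>
    moreover have "1 / (real (card V) - 1) \<le> \<eta> m"
    proof -
      define n where "n = real (card V)"
      have n2: "n \<ge> 2" using n by (simp add: n_def)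
      have "N = n * (n - 1) / 2"
        by (simp add: N_def n_def card_nsets real_choose_two)
      then have "real m \<le> n * (n - 1)" using s(3,4) by linarith
      have "(1 / (n - 1))\<^sup>2 \<le> 1 / (n - 1)"
        using n2 by (simp add: power2_eq_square divide_simps)
      also have "\<dots> = n / (n * (n - 1))" using n2 by simp
      also have "\<dots> \<le> n / real m"
        using \<open>real m \<le> n * (n - 1)\<close> n2 m by (intro divide_left_mono) (auto simp: n_def)
      finally show ?thesis unfolding \<eta>_def n_def[symmetric] by (rule real_le_rsqrt)
    qed
    moreover have "\<eta> m \<le> 1 / \<delta> * \<eta> m"
      using \<delta> \<eta>0[of m] mult_right_mono[of 1 "1 / \<delta>" "\<eta> m"] by simp
    moreover have "25 / \<delta> * \<eta> m = 24 / \<delta> * \<eta> m + 1 / \<delta> * \<eta> m" by (simp add: add_divide_distrib[symmetric] distrib_right[symmetric])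
    ultimately show ?case using loss[OF m] by simp
  next
    case (Suc d)
    then have m: "card V \<le> m" "real (m + 1) \<le> (1 - \<delta> / 2) * N" by simp_all
    note s = small[OF m(2)]
    have "x (Suc d) m \<ge> x d (Suc m) - loss m"
      unfolding x_def N_def loss_def
    proof (rule mean_equiv_pairs_step[OF V(1) s(1)])
      fix H e assume H: "H \<subseteq> ?P"
      show "equiv_pairs d r V H \<subseteq> ?P" by (rule equiv_pairs_subset)
      show "\<exists>f :: 'a \<Rightarrow> 'a set. ?P - equiv_pairs d r V H = crossing V f"
        by (rule nsets_minus_equiv_pairs) blast
      assume "e \<in> H" "e \<in> equiv_pairs d r V H"
      then show "e \<in> equiv_pairs (Suc d) r V (H - {e})"
        by (intro equiv_pairs_Suc_remove_edge[OF V(1) H _ r])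
    qed
    moreover have "x d (Suc m) \<ge> 1 / real r - 25 * (real (d + 1) / \<delta>) * \<eta> (Suc m)"
      using Suc.prems by (intro Suc.IH) auto
    moreover have "25 * (real (d + 1) / \<delta>) * \<eta> (Suc m) \<le> 25 * (real (d + 1) / \<delta>) * \<eta> m"
      using \<eta>_anti[of m "Suc m"] m \<delta> by (intro mult_left_mono) auto
    moreover have "24 / \<delta> * \<eta> m \<le> 25 / \<delta> * \<eta> m"
      using \<delta> \<eta>0[of m] by (intro mult_right_mono divide_right_mono) auto
    moreover have "25 * (real (Suc d + 1) / \<delta>) * \<eta> m = 25 * (real (d + 1) / \<delta>) * \<eta> m + 25 / \<delta> * \<eta> m"
      using \<delta> by (simp add: field_simps)
    ultimately show ?case using loss[OF m] by linarith
  qed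
  from this[of m d] m show ?thesis unfolding x_def \<eta>_def N_def by blast
qed

section \<open>The probability of not being rigid\<close>

lemma prob_random_graph:
  assumes "m \<le> n choose 2"
  shows "measure_pmf.prob (random_graph n m) {G. R G}
    = real (card {E \<in> msubsets (nsets {1..n} 2) m. R ({1..n}, E)}) / real ((n choose 2) choose m)"
proof -
  define V where "V = {1..n}"
  define P where "P = nsets V 2"
  have P: "finite P" "card P = n choose 2" by (simp_all add: P_def V_def finite_imp_finite_nsets card_nsets)
  have eq: "{(V, E) | E. E \<subseteq> P \<and> card E = m} = Pair V ` msubsets P m" by auto
  have c: "card (msubsets P m) = (n choose 2) choose m" using P by (simp add: n_subsets)
  then have ne: "msubsets P m \<noteq> {}" using assms by (metis card.empty binomial_eq_0_iff not_le)
  have inj: "card (Pair V ` A) = card A" for A :: "nat set set set"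
    by (rule card_image) (simp add: inj_on_def)
  have "Pair V ` msubsets P m \<inter> {G. R G} = Pair V ` {E \<in> msubsets P m. R (V, E)}" by auto
  moreover have "measure_pmf.prob (random_graph n m) {G. R G}
      = real (card (Pair V ` msubsets P m \<inter> {G. R G})) / real (card (Pair V ` msubsets P m))"
    unfolding random_graph_def V_def[symmetric] P_def[symmetric] eq
    using ne P(1) by (intro measure_pmf_of_set) auto
  ultimately show ?thesis unfolding V_def[symmetric] P_def[symmetric] by (simp only: inj c)
qed

text \<open>The equivalent pairs lie inside the parts of a maximum cut, which contain at most \<open>1/r\<close> of the
  edges, hence not many more than \<open>1/r\<close> of the pairs.\<close>

lemma card_equiv_pairs_le:
  assumes V: "finite V" and E: "E \<subseteq> nsets V 2" "E \<noteq> {}" and r: "0 < r"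
  shows "real (card (equiv_pairs d r V E)) / real (card (nsets V 2))
    \<le> 1 / real r + 2 * discrepancy V E / real (card E)"
proof -
  let ?P = "nsets V 2"
  have P: "finite ?P" "finite E" using V E finite_imp_finite_nsets finite_subset by blast+
  have pos: "real (card E) > 0" "real (card ?P) > 0"
    using E P by (auto simp: card_gt_0_iff)
  obtain Q where Q: "is_rcut r (V, E) Q" "cut_size r (V, E) Q = max_cut r (V, E)"
    using max_cut_attained[OF V E(1) r] by blast
  obtain f where "f ` V \<subseteq> {..<r}" and f: "cut_pairs V r Q = crossing V f"
    by (rule cut_pairs_eq_crossing[OF Q(1)])
  have "e \<notin> cut_pairs V r Q" if "e \<in> equiv_pairs d r V E" for e
    using that Q by (auto simp: equiv_pairs_iff)
  then have "equiv_pairs d r V E \<subseteq> ?P - crossing V f"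
    using equiv_pairs_subset[of d r V E] unfolding f by blast
  then have "card (equiv_pairs d r V E) \<le> card (?P - crossing V f)" using P by (intro card_mono) auto
  also have "\<dots> = card ?P - card (crossing V f)"
    using P crossing_subset finite_subset by (intro card_Diff_subset) blast+
  finally have "real (card (equiv_pairs d r V E)) \<le> real (card ?P) - real (card (crossing V f))"
    using card_mono[OF P(1) crossing_subset[of V f]] by linarith
  then have "real (card (equiv_pairs d r V E)) / real (card ?P)
      \<le> (real (card ?P) - real (card (crossing V f))) / real (card ?P)"
    by (intro divide_right_mono) auto
  also have "\<dots> = 1 - real (card (crossing V f)) / real (card ?P)"
    using pos by (simp add: diff_divide_distrib)
  finally have A: "real (card (equiv_pairs d r V E)) / real (card ?P)
      \<le> 1 - real (card (crossing V f)) / real (card ?P)" .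
  have "(1 - 1 / real r) * real (card E) \<le> real (card (E \<inter> crossing V f))"
    using max_cut_ge[OF V E(1) r] Q cut_size_eq[OF E(1), of r Q] f by simp
  also have "\<dots> \<le> real (card E) / real (card ?P) * real (card (crossing V f)) + 2 * discrepancy V E"
    by (rule card_crossing_le_discrepancy[OF V E(1)])
  also have "\<dots> = (real (card (crossing V f)) / real (card ?P) + 2 * discrepancy V E / real (card E)) * real (card E)"
    using pos by (simp add: field_simps)
  finally have "1 - 1 / real r \<le> real (card (crossing V f)) / real (card ?P) + 2 * discrepancy V E / real (card E)"
    using pos(1) by (rule mult_right_le_imp_le)
  with A show ?thesis by linarith
qed

text \<open>Markov's inequality, applied to the variable \<open>W\<close> below.\<close>

lemma prob_not_rigid_le:
  fixes \<delta> \<epsilon> :: real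
  assumes \<delta>: "0 < \<delta>" "\<delta> < 1" and \<epsilon>: "0 < \<epsilon>" "\<epsilon> < 1" and r: "1 \<le> r" and m: "1 \<le> m"
    and m_le: "real m \<le> (1 - \<delta>) * real (n choose 2)"
  shows "measure_pmf.prob (random_graph n m) {G. \<not> rigid d r \<epsilon> G}
    \<le> 33 * real r / \<epsilon> * ((real d + 1) / \<delta> * sqrt (real n / real m))"
proof -
  define V where "V = {1..n}"
  define P where "P = nsets V 2"
  define N where "N = real (card P)"
  define \<eta> where "\<eta> = sqrt (real n / real m)"
  define T where "T = (real d + 1) / \<delta> * \<eta>"
  have V: "finite V" "card V = n" by (auto simp: V_def)
  have P: "finite P" "card P = n choose 2" using V finite_imp_finite_nsets[of V] card_nsets[of V 2] by (auto simp: P_def)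
  have \<delta>N: "\<delta> * N \<ge> 0" using \<delta> by (simp add: N_def)
  have mN: "real m \<le> N - \<delta> * N" using m_le by (simp add: N_def P algebra_simps)
  have Npos: "N \<ge> 1" using m mN \<delta>N by linarith
  have n: "2 \<le> n"
  proof (rule ccontr)
    assume "\<not> 2 \<le> n"
    then have "n choose 2 = 0" by (simp add: binomial_eq_0)
    then show False using Npos unfolding N_def P(2) by linarith
  qed
  have rr: "real r / \<epsilon> > 1" using r \<epsilon> by (simp add: less_divide_eq)
  have mle: "m \<le> card P" using mN \<delta>N unfolding N_def by linarith
  have \<eta>pos: "\<eta> > 0" using n m by (simp add: \<eta>_def)
  have T\<eta>: "\<eta> \<le> T"
  proof -
    have "1 \<le> (real d + 1) / \<delta>" using \<delta> by (simp add: le_divide_eq)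
    then show ?thesis using \<eta>pos mult_right_mono[of 1 "(real d + 1) / \<delta>" \<eta>] by (simp add: T_def)
  qed
  show ?thesis
  proof (cases "33 * T \<ge> 1")
    \<comment> \<open>the bound exceeds \<open>1\<close>\<close>
    case True
    have "measure_pmf.prob (random_graph n m) {G. \<not> rigid d r \<epsilon> G} \<le> 1 * 1" by simp
    also have "\<dots> \<le> real r / \<epsilon> * (33 * T)" using True rr by (intro mult_mono) auto
    finally show ?thesis by (simp add: T_def \<eta>_def mult_ac)
  next
    case False
    have nm: "n \<le> m"
    proof (rule ccontr)
      assume "\<not> n \<le> m"
      then have "1 \<le> \<eta>" using m by (simp add: \<eta>_def)
      then show False using False T\<eta> by linarith
    qed
    \<comment> \<open>since \<open>T\<close> is small, \<open>d + 1\<close> is small compared with the number of non-edges\<close>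
    have "1 \<le> \<eta> * N"
    proof -
      have "(1 / N)\<^sup>2 \<le> 1 / N" using Npos by (simp add: power2_eq_square divide_simps)
      also have "\<dots> \<le> real n / real m"
        using n m mN \<delta>N Npos by (intro frac_le) auto
      finally have "1 / N \<le> \<eta>" unfolding \<eta>_def by (rule real_le_rsqrt)
      then show ?thesis using Npos by (simp add: divide_le_eq)
    qed
    then have "real d + 1 \<le> (real d + 1) * (\<eta> * N)" by (simp add: mult_le_cancel_left1)
    also have "\<dots> = T * (\<delta> * N)" using \<delta> by (simp add: T_def)
    also have "\<dots> \<le> 1 / 33 * (\<delta> * N)" using False \<delta>N by (intro mult_right_mono) auto
    finally have room: "real (m + d + 1) \<le> (1 - \<delta> / 2) * N"
      using mN \<delta>N by (simp add: algebra_simps)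
    \<comment> \<open>the upper bound for the proportion of equivalent pairs minus this proportion\<close>
    define W where "W E = 1 / real r + 2 / real m * discrepancy V E - card (equiv_pairs d r V E) / N" for E
    have W: "W E \<ge> 0" if E: "E \<in> msubsets P m" for E
    proof -
      have "E \<noteq> {}" using E m by auto
      then show ?thesis
        using E r card_equiv_pairs_le[OF V(1), of E r d] by (auto simp: W_def P_def N_def)
    qed
    have W': "\<epsilon> / real r \<le> W E" if E: "E \<in> msubsets P m" "\<not> rigid d r \<epsilon> (V, E)" for E
    proof -
      have "real (card (equiv_pairs d r V E)) < (1 - \<epsilon>) / real r * N"
        using E(2) by (simp add: rigid_def equiv_pairs_def N_def P V not_le)
      then have "real (card (equiv_pairs d r V E)) / N < (1 - \<epsilon>) / real r"
        using Npos by (simp add: divide_less_eq)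
      moreover have "0 \<le> 2 / real m * discrepancy V E"
        using discrepancy_ge[OF V(1), of "{}" E] by (simp add: crossing_def)
      ultimately show ?thesis unfolding W_def diff_divide_distrib by linarith
    qed
    have pr: "measure_pmf.prob (random_graph n m) {G. \<not> rigid d r \<epsilon> G}
        = real (card {E \<in> msubsets P m. \<not> rigid d r \<epsilon> (V, E)}) / real (card P choose m)"
      using prob_random_graph[of m n "\<lambda>G. \<not> rigid d r \<epsilon> G"] mle
      unfolding P(2) unfolding P_def V_def .
    have "card {E \<in> msubsets P m. \<not> rigid d r \<epsilon> (V, E)} * (\<epsilon> / real r)
        = (\<Sum>E | E \<in> msubsets P m \<and> \<not> rigid d r \<epsilon> (V, E). \<epsilon> / real r)" by simp
    also have "\<dots> \<le> (\<Sum>E | E \<in> msubsets P m \<and> \<not> rigid d r \<epsilon> (V, E). W E)"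
      using W' by (intro sum_mono) auto
    also have "\<dots> \<le> (\<Sum>E\<in>msubsets P m. W E)"
      using W P by (intro sum_mono2) auto
    finally have "card {E \<in> msubsets P m. \<not> rigid d r \<epsilon> (V, E)} * (\<epsilon> / real r) / real (card P choose m)
        \<le> mean P m W"
      unfolding mean_def by (intro divide_right_mono) auto
    also have "card {E \<in> msubsets P m. \<not> rigid d r \<epsilon> (V, E)} * (\<epsilon> / real r) / real (card P choose m)
        = measure_pmf.prob (random_graph n m) {G. \<not> rigid d r \<epsilon> G} * (\<epsilon> / real r)"
      unfolding pr by simp
    also have "mean P m W = 1 / real r + 2 / real m * mean P m (discrepancy V)
        - mean P m (\<lambda>E. card (equiv_pairs d r V E)) / N"
      unfolding W_def mean_diff mean_add mean_cmult mean_const[OF P(1) mle]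
      using mean_cmult[of P m "1 / N" "\<lambda>E. card (equiv_pairs d r V E)"] by simp
    also have "\<dots> \<le> 1 / real r + 8 * \<eta> - (1 / real r - 25 * T)"
    proof -
      have "2 / real m * mean P m (discrepancy V) \<le> 2 / real m * (4 * (real m * \<eta>))"
        using mean_discrepancy_le[of V m] V n nm mle by (intro mult_left_mono) (auto simp: P_def \<eta>_def)
      also have "\<dots> = 8 * \<eta>" using m by simp
      finally have "2 / real m * mean P m (discrepancy V) \<le> 8 * \<eta>" .
      moreover have "1 / real r - 25 * T \<le> mean P m (\<lambda>E. card (equiv_pairs d r V E)) / N"
      proof -
        have "25 * (real (d + 1) / \<delta>) * \<eta> = 25 * T" by (simp add: T_def)
        moreover have "1 / real r - 25 * (real (d + 1) / \<delta>) * \<eta>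
            \<le> mean P m (\<lambda>E. card (equiv_pairs d r V E)) / N"
          using mean_equiv_pairs_ge[of V r \<delta> m d] V n nm r \<delta> room
          unfolding \<eta>_def N_def P_def by simp
        ultimately show ?thesis by simp
      qed
      ultimately show ?thesis by linarith
    qed
    also have "\<dots> \<le> 33 * T" using T\<eta> by simp
    finally have "measure_pmf.prob (random_graph n m) {G. \<not> rigid d r \<epsilon> G} \<le> 33 * T / (\<epsilon> / real r)"
      using \<epsilon> r by (subst pos_le_divide_eq) auto
    then show ?thesis by (simp add: T_def \<eta>_def mult_ac)
  qed
qed

theorem theorem2p1:
  shows "\<exists>C::real. \<forall>(\<delta>::real) (\<epsilon>::real) (d::nat) (m::nat) (n::nat) (r::nat).
    0 < \<delta> \<and> \<delta> < 1 \<and> 0 < \<epsilon> \<and> \<epsilon> < 1 \<and> 2 \<le> r \<and> 1 \<le> m \<and>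
    real m \<le> (1 - \<delta>) * real (n choose 2) \<longrightarrow>
    measure_pmf.prob (random_graph n m) {G. \<not> rigid d r \<epsilon> G}
      \<le> C * real r / \<epsilon> *
        (((real d + 1) / \<delta> + real r) * sqrt (real n / real m) + root 4 (real n / real m))"
proof (intro exI[of _ 33] allI impI, elim conjE)
  fix \<delta> \<epsilon> :: real and d m n r :: nat
  assume \<delta>: "0 < \<delta>" "\<delta> < 1" and \<epsilon>: "0 < \<epsilon>" "\<epsilon> < 1" and r: "2 \<le> r" and m: "1 \<le> m"
    "real m \<le> (1 - \<delta>) * real (n choose 2)"
  have "measure_pmf.prob (random_graph n m) {G. \<not> rigid d r \<epsilon> G}
      \<le> 33 * real r / \<epsilon> * ((real d + 1) / \<delta> * sqrt (real n / real m))"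
    using \<delta> \<epsilon> r m by (intro prob_not_rigid_le) auto
  also have "\<dots> \<le> 33 * real r / \<epsilon> *
        (((real d + 1) / \<delta> + real r) * sqrt (real n / real m) + root 4 (real n / real m))"
    using \<epsilon> by (intro mult_left_mono) (auto simp: distrib_right intro!: add_nonneg_nonneg)
  finally show "measure_pmf.prob (random_graph n m) {G. \<not> rigid d r \<epsilon> G}
      \<le> 33 * real r / \<epsilon> *
        (((real d + 1) / \<delta> + real r) * sqrt (real n / real m) + root 4 (real n / real m))" .
qed

end
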